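(* Let $q\in[0,1)$. In the Hilbert space $\mathbf H_{2,q}$ it holds that $$M_z^*=R_qM_zR_0 .$$
   Context: For $q\in[0,1)$ put $[n]_q=1+q+\cdots+q^{n-1}$ for $n\ge 1$, $[0]_q!=1$ and $[n]_q!=[1]_q[2]_q\cdots[n]_q$. The space $\mathbf H_{2,q}$ is the reproducing kernel Hilbert space of functions analytic in $|z|<1/\sqrt{1-q}$ with reproducing kernel $\sum_{n=0}^\infty \frac{z^n\overline w^n}{[n]_q!}$. Equivalently, it consists of the power series $f(z)=\sum_{n\ge 0} a_nz^n$ with $\sum_{n\ge 0} [n]_q!\,|a_n|^2<\infty$, with inner product $\langle \sum a_nz^n,\sum b_nz^n\rangle=\sum [n]_q!\,a_n\overline{b_n}$. The operator $M_z$ is multiplication by $z$, $R_qf(z)=\frac{f(z)-f(qz)}{(1-q)z}$ and $R_0f(z)=\frac{f(z)-f(0)}{z}$ (both extended analytically to $z=0$). *)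

theory Defs
  imports "HOL-Complex_Analysis.Complex_Analysis"
begin

definition qnum :: "real \<Rightarrow> nat \<Rightarrow> real" where
  "qnum q n = (\<Sum>k<n. q ^ k)"

definition qfact :: "real \<Rightarrow> nat \<Rightarrow> real" where
  "qfact q n = (\<Prod>k=1..n. qnum q k)"

definition qdisc :: "real \<Rightarrow> complex set" where
  "qdisc q = ball 0 (1 / sqrt (1 - q))"

definition taylor_coeff :: "(complex \<Rightarrow> complex) \<Rightarrow> nat \<Rightarrow> complex" where
  "taylor_coeff f n = fps_nth (fps_expansion f 0) n"

text \<open>
  Functions on the disc are represented by total functions that vanish outside
  the disc, so that two elements of the space are equal iff they agree on the disc.
\<close>

definition H2 :: "real \<Rightarrow> (complex \<Rightarrow> complex) set" where
  "H2 q = {f. f holomorphic_on qdisc q \<and>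
              summable (\<lambda>n. qfact q n * (cmod (taylor_coeff f n))\<^sup>2) \<and>
              (\<forall>z. z \<notin> qdisc q \<longrightarrow> f z = 0)}"

definition H2_inner :: "real \<Rightarrow> (complex \<Rightarrow> complex) \<Rightarrow> (complex \<Rightarrow> complex) \<Rightarrow> complex" where
  "H2_inner q f g =
     (\<Sum>n. of_real (qfact q n) * taylor_coeff f n * cnj (taylor_coeff g n))"

definition Mz :: "(complex \<Rightarrow> complex) \<Rightarrow> complex \<Rightarrow> complex" where
  "Mz f = (\<lambda>z. z * f z)"

text \<open>
  The analytic extension to 0 of a function on the punctured disc; the limit at 0
  exists in the uses below because the singularity is removable.
\<close>

definition extend_at_0 :: "real \<Rightarrow> (complex \<Rightarrow> complex) \<Rightarrow> complex \<Rightarrow> complex" where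
  "extend_at_0 q g =
     (\<lambda>z. if z \<notin> qdisc q then 0 else if z = 0 then Lim (at 0) g else g z)"

definition Rq :: "real \<Rightarrow> (complex \<Rightarrow> complex) \<Rightarrow> complex \<Rightarrow> complex" where
  "Rq q f = extend_at_0 q (\<lambda>z. (f z - f (of_real q * z)) / (of_real (1 - q) * z))"

text \<open>In \<open>R0\<close> the parameter \<open>q\<close> only determines the disc.\<close>

definition R0 :: "real \<Rightarrow> (complex \<Rightarrow> complex) \<Rightarrow> complex \<Rightarrow> complex" where
  "R0 q f = extend_at_0 q (\<lambda>z. (f z - f 0) / z)"

text \<open>
  Bounded operators and adjoints on a space \<open>H\<close> of functions with inner
  product \<open>ip\<close> (linear in the first argument). By the Riesz representation theorem
  the description in \<open>hadjoint\<close> determines a unique element when \<open>H\<close> is a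
  Hilbert space and \<open>T\<close> is bounded.
\<close>

definition bounded_operator_on ::
  "(complex \<Rightarrow> complex) set \<Rightarrow> ((complex \<Rightarrow> complex) \<Rightarrow> (complex \<Rightarrow> complex) \<Rightarrow> complex) \<Rightarrow>
   ((complex \<Rightarrow> complex) \<Rightarrow> (complex \<Rightarrow> complex)) \<Rightarrow> bool" where
  "bounded_operator_on H ip T \<longleftrightarrow>
     (\<forall>f\<in>H. T f \<in> H) \<and>
     (\<forall>f\<in>H. \<forall>g\<in>H. T (\<lambda>z. f z + g z) = (\<lambda>z. T f z + T g z)) \<and>
     (\<forall>c. \<forall>f\<in>H. T (\<lambda>z. c * f z) = (\<lambda>z. c * T f z)) \<and>
     (\<exists>C. \<forall>f\<in>H. sqrt (Re (ip (T f) (T f))) \<le> C * sqrt (Re (ip f f)))"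

definition hadjoint ::
  "(complex \<Rightarrow> complex) set \<Rightarrow> ((complex \<Rightarrow> complex) \<Rightarrow> (complex \<Rightarrow> complex) \<Rightarrow> complex) \<Rightarrow>
   ((complex \<Rightarrow> complex) \<Rightarrow> (complex \<Rightarrow> complex)) \<Rightarrow> (complex \<Rightarrow> complex) \<Rightarrow> (complex \<Rightarrow> complex)" where
  "hadjoint H ip T g = (THE h. h \<in> H \<and> (\<forall>f\<in>H. ip (T f) g = ip f h))"

end

(* On monomials M_z sends z^n to z^(n+1), while the squared norm of z^n is [n]_q!, so M_z* sends
   z^(n+1) to [n+1]_q z^n and annihilates constants. The operator M_z R_0 removes the constant
   term and R_q sends z^(n+1) to [n+1]_q z^n, so both sides have the same Taylor coefficients.
   Boundedness comes from [n]_q <= 1/(1-q). *)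
theory Submission
  imports Defs
begin

section \<open>Power series on the disc\<close>

lemma qdisc_open [simp]: "open (qdisc q)"
  by (simp add: qdisc_def)

lemma zero_in_qdisc [simp]: "q < 1 \<Longrightarrow> 0 \<in> qdisc q"
  by (simp add: qdisc_def)

text \<open>\<open>Rq\<close> evaluates a function at \<open>q * z\<close> as well as at
  \<open>z\<close>, so both points must lie where its Taylor series converges to it.\<close>

lemma qdisc_scale:
  assumes "0 \<le> q" "q < 1" "z \<in> qdisc q"
  shows "of_real q * z \<in> qdisc q"
proof -
  have "q * cmod z \<le> cmod z"
    using assms by (simp add: mult_left_le_one_le)
  with assms show ?thesis
    by (simp add: qdisc_def norm_mult)
qed

lemma taylor_sums:
  assumes "f holomorphic_on qdisc q" "z \<in> qdisc q"
  shows "(\<lambda>n. taylor_coeff f n * z ^ n) sums f z"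
  using holomorphic_power_series[of f 0 _ z] assms
  by (simp add: qdisc_def taylor_coeff_def fps_expansion_def)

lemma sums_imp_holomorphic:
  assumes "\<And>z. z \<in> qdisc q \<Longrightarrow> (\<lambda>n. c n * z ^ n) sums f z"
  shows "f holomorphic_on qdisc q"
  unfolding qdisc_def
  by (rule power_series_holomorphic[where a = c]) (use assms in \<open>simp add: qdisc_def\<close>)

text \<open>Power series expansions at 0 are unique, and pointwise sums on the disc already provide
  one. The coefficients of images under the operators are read off in this way.\<close>

lemma sums_imp_taylor_coeff:
  assumes "q < 1" and "\<And>z. z \<in> qdisc q \<Longrightarrow> (\<lambda>n. c n * z ^ n) sums f z"
  shows "taylor_coeff f n = c n"
proof -
  have "eventually (\<lambda>u. u \<in> qdisc q) (nhds 0)"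
    by (rule eventually_nhds_in_open) (use assms in auto)
  then have "f has_fps_expansion Abs_fps c"
    by (intro has_fps_expansionI) (auto elim!: eventually_mono dest: assms(2))
  moreover have "f has_fps_expansion fps_expansion f 0"
    by (rule has_fps_expansion_fps_expansion[of "qdisc q"])
      (use assms sums_imp_holomorphic in auto)
  ultimately have "fps_expansion f 0 = Abs_fps c"
    using fps_expansion_unique_complex by blast
  then show ?thesis
    by (simp add: taylor_coeff_def)
qed

text \<open>At 0 the series converges trivially, so its sum is holomorphic on the whole disc, and
  continuity makes its value at 0 the limit chosen by \<open>extend_at_0\<close>. This settles the
  removable singularities of \<open>R0\<close> and \<open>Rq\<close> alike.\<close>

lemma extend_at_0_sums:
  assumes "q < 1" and z: "z \<in> qdisc q"
    and g: "\<And>z. z \<in> qdisc q \<Longrightarrow> z \<noteq> 0 \<Longrightarrow> (\<lambda>n. c n * z ^ n) sums g z"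
  shows "(\<lambda>n. c n * z ^ n) sums extend_at_0 q g z"
proof -
  define h where "h z = (\<Sum>n. c n * z ^ n)" for z
  have sums: "(\<lambda>n. c n * z ^ n) sums h z" if "z \<in> qdisc q" for z
  proof (cases "z = 0")
    case True
    then show ?thesis
      using powser_sums_zero[of c] by (simp add: h_def sums_iff)
  next
    case False
    then show ?thesis
      using g[OF that] by (simp add: h_def sums_iff)
  qed
  have "h holomorphic_on qdisc q"
    using sums by (rule sums_imp_holomorphic)
  then have "isCont h 0"
    using assms(1) by (metis holomorphic_on_imp_continuous_on continuous_on_eq_continuous_at
        qdisc_open zero_in_qdisc)
  then have lim_h: "(h \<longlongrightarrow> h 0) (at 0)"
    by (simp add: isCont_def)
  have gh: "g z = h z" if "z \<in> qdisc q" "z \<noteq> 0" for z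
    using g[OF that] sums[OF that(1)] sums_unique2 by blast
  have "(g \<longlongrightarrow> h 0) (at 0)"
    by (rule Lim_transform_within_open[OF lim_h, of "qdisc q"]) (use assms(1) gh in auto)
  then have "Lim (at 0) g = h 0"
    by (intro tendsto_Lim) auto
  then have "extend_at_0 q g z = h z"
    using z gh by (simp add: extend_at_0_def)
  then show ?thesis
    using sums[OF z] by simp
qed

section \<open>The operators on Taylor coefficients\<close>

text \<open>On coefficient sequences this right shift is the action of \<open>Mz\<close>.\<close>

definition prepend0 :: "(nat \<Rightarrow> 'a::zero) \<Rightarrow> nat \<Rightarrow> 'a" where
  "prepend0 c n = (case n of 0 \<Rightarrow> 0 | Suc m \<Rightarrow> c m)"

lemma prepend0_simps [simp]: "prepend0 c 0 = 0" "prepend0 c (Suc n) = c n"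
  by (simp_all add: prepend0_def)

lemma Mz_sums:
  assumes "f holomorphic_on qdisc q" "z \<in> qdisc q"
  shows "(\<lambda>n. prepend0 (taylor_coeff f) n * z ^ n) sums Mz f z"
proof (rule sums_Suc_imp)
  show "(\<lambda>n. prepend0 (taylor_coeff f) (Suc n) * z ^ Suc n) sums Mz f z"
    using sums_mult[OF taylor_sums[OF assms], of z] by (simp add: Mz_def mult_ac)
qed simp

text \<open>Subtracting \<open>f 0\<close> cancels the constant term, and division by
  \<open>z\<close> then shifts the coefficients to the left.\<close>

lemma R0_sums:
  assumes "q < 1" "f holomorphic_on qdisc q" "z \<in> qdisc q"
  shows "(\<lambda>n. taylor_coeff f (Suc n) * z ^ n) sums R0 q f z"
  unfolding R0_def
proof (rule extend_at_0_sums[OF assms(1,3)])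
  fix z assume z: "z \<in> qdisc q" "z \<noteq> 0"
  have "f 0 = taylor_coeff f 0"
    using sums_unique2[OF taylor_sums[OF assms(2) zero_in_qdisc[OF assms(1)]] powser_sums_zero] .
  then have "(\<lambda>n. taylor_coeff f (Suc n) * z ^ Suc n) sums (f z - f 0)"
    using taylor_sums[OF assms(2) z(1)] by (subst sums_Suc_iff) simp
  from sums_divide[OF this, of z] z
  show "(\<lambda>n. taylor_coeff f (Suc n) * z ^ n) sums ((f z - f 0) / z)"
    by simp
qed

text \<open>Termwise \<open>z^k - (q * z)^k = (1 - q^k) * z^k\<close>, and the geometric sum turns
  \<open>(1 - q^k) / (1 - q)\<close> into \<open>qnum q k\<close>.\<close>

lemma Rq_sums:
  assumes "0 \<le> q" "q < 1" "f holomorphic_on qdisc q" "z \<in> qdisc q"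
  shows "(\<lambda>n. of_real (qnum q (Suc n)) * taylor_coeff f (Suc n) * z ^ n) sums Rq q f z"
  unfolding Rq_def
proof (rule extend_at_0_sums[OF assms(2,4)])
  fix z assume z: "z \<in> qdisc q" "z \<noteq> 0"
  let ?a = "taylor_coeff f"
  have "(\<lambda>n. ?a n * z ^ n - ?a n * (of_real q * z) ^ n) sums (f z - f (of_real q * z))"
    by (intro sums_diff taylor_sums[OF assms(3)] z qdisc_scale[OF assms(1,2)])
  \<comment> \<open>The term of index 0 is \<open>?a 0 - ?a 0 = 0\<close>, so the series may start
    at index 1 with the same sum.\<close>
  then have "(\<lambda>n. ?a (Suc n) * z ^ Suc n - ?a (Suc n) * (of_real q * z) ^ Suc n)
               sums (f z - f (of_real q * z))"
    by (subst sums_Suc_iff) simp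
  then have "(\<lambda>n. (?a (Suc n) * z ^ Suc n - ?a (Suc n) * (of_real q * z) ^ Suc n)
                   / (of_real (1 - q) * z))
               sums ((f z - f (of_real q * z)) / (of_real (1 - q) * z))"
    by (rule sums_divide)
  moreover have "(?a (Suc n) * z ^ Suc n - ?a (Suc n) * (of_real q * z) ^ Suc n)
                   / (of_real (1 - q) * z)
                 = of_real (qnum q (Suc n)) * ?a (Suc n) * z ^ n" for n
  proof -
    have "(1 - q) * qnum q (Suc n) = 1 - q ^ Suc n"
      using one_diff_power_eq[of q "Suc n"] by (simp add: qnum_def)
    then have qnum: "of_real (1 - q) * of_real (qnum q (Suc n)) = (1 - of_real q ^ Suc n :: complex)"
      by (metis of_real_1 of_real_diff of_real_mult of_real_power)
    have "?a (Suc n) * z ^ Suc n - ?a (Suc n) * (of_real q * z) ^ Suc n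
        = (1 - of_real q ^ Suc n) * (?a (Suc n) * z ^ n * z)"
      by (simp add: power_mult_distrib algebra_simps)
    then have "?a (Suc n) * z ^ Suc n - ?a (Suc n) * (of_real q * z) ^ Suc n
        = of_real (qnum q (Suc n)) * ?a (Suc n) * z ^ n * (of_real (1 - q) * z)"
      unfolding qnum[symmetric] by (simp only: mult_ac)
    moreover have "of_real (1 - q) * z \<noteq> 0"
      using z assms(2) by (simp del: of_real_diff)
    ultimately show ?thesis
      by (simp add: nonzero_divide_eq_eq)
  qed
  ultimately show "(\<lambda>n. of_real (qnum q (Suc n)) * ?a (Suc n) * z ^ n)
               sums ((f z - f (of_real q * z)) / (of_real (1 - q) * z))"
    by simp
qed

lemma taylor_coeff_Mz:
  assumes "q < 1" "f holomorphic_on qdisc q"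
  shows "taylor_coeff (Mz f) = prepend0 (taylor_coeff f)"
  using sums_imp_taylor_coeff[OF assms(1) Mz_sums[OF assms(2)]] by blast

text \<open>\<open>Mz\<close> after \<open>R0\<close> replaces the constant coefficient by 0 and
  keeps the others; the formula for \<open>Rq\<close> involves only the others.\<close>

lemma RqMzR0_sums:
  assumes "0 \<le> q" "q < 1" "f holomorphic_on qdisc q" "z \<in> qdisc q"
  shows "(\<lambda>n. of_real (qnum q (Suc n)) * taylor_coeff f (Suc n) * z ^ n)
           sums Rq q (Mz (R0 q f)) z"
proof -
  have R0: "R0 q f holomorphic_on qdisc q"
    using R0_sums[OF assms(2,3)] by (rule sums_imp_holomorphic)
  have "taylor_coeff (R0 q f) n = taylor_coeff f (Suc n)" for n
    by (rule sums_imp_taylor_coeff[OF assms(2) R0_sums[OF assms(2,3)]])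
  then have "taylor_coeff (Mz (R0 q f)) (Suc n) = taylor_coeff f (Suc n)" for n
    by (simp add: taylor_coeff_Mz[OF assms(2) R0])
  moreover have "Mz (R0 q f) holomorphic_on qdisc q"
    using Mz_sums[OF R0] by (rule sums_imp_holomorphic)
  ultimately show ?thesis
    using Rq_sums[OF assms(1,2), of "Mz (R0 q f)" z] assms(4) by simp
qed

section \<open>The weighted sequence space\<close>

lemma qnum_nonneg: "0 \<le> q \<Longrightarrow> 0 \<le> qnum q n"
  by (simp add: qnum_def sum_nonneg)

text \<open>A partial sum of the geometric series is at most its limit. This bound, uniform in
  \<open>n\<close>, keeps both \<open>Mz\<close> and its adjoint inside the space.\<close>

lemma qnum_le:
  assumes "0 \<le> q" "q < 1"
  shows "qnum q n \<le> 1 / (1 - q)"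
proof -
  have "(1 - q) * qnum q n = 1 - q ^ n"
    by (simp add: qnum_def one_diff_power_eq)
  also have "\<dots> \<le> 1"
    using assms by simp
  finally show ?thesis
    using assms by (simp add: field_simps)
qed

lemma qfact_Suc: "qfact q (Suc n) = qnum q (Suc n) * qfact q n"
  by (simp add: qfact_def mult.commute)

lemma qfact_pos:
  assumes "0 \<le> q"
  shows "0 < qfact q n"
proof -
  \<comment> \<open>For \<open>k \<ge> 1\<close> the sum contains \<open>q ^ 0\<close>, which is 1
    even for \<open>q = 0\<close>.\<close>
  have "1 \<le> qnum q k" if "k \<ge> 1" for k
    using assms that member_le_sum[of 0 "{..<k}" "\<lambda>k. q ^ k"] by (auto simp: qnum_def)
  then show ?thesis
    unfolding qfact_def by (intro prod_pos) (force intro: less_le_trans[OF zero_less_one])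
qed

lemma qfact_Suc_le:
  assumes "0 \<le> q" "q < 1"
  shows "qfact q (Suc n) \<le> 1 / (1 - q) * qfact q n"
  unfolding qfact_Suc using assms qnum_le qfact_pos[of q n] by (intro mult_right_mono) auto

section \<open>Membership, equality and inner product in terms of coefficients\<close>

lemma H2_holomorphic: "f \<in> H2 q \<Longrightarrow> f holomorphic_on qdisc q"
  and H2_summable: "f \<in> H2 q \<Longrightarrow> summable (\<lambda>n. qfact q n * (cmod (taylor_coeff f n))\<^sup>2)"
  and H2_outside: "f \<in> H2 q \<Longrightarrow> z \<notin> qdisc q \<Longrightarrow> f z = 0"
  by (auto simp: H2_def)

text \<open>Uniqueness identifies \<open>c\<close> with the Taylor coefficients, so the norm
  condition can be checked on an explicit sequence.\<close>

lemma H2I: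
  assumes "q < 1"
    and "\<And>z. z \<in> qdisc q \<Longrightarrow> (\<lambda>n. c n * z ^ n) sums f z"
    and "\<And>z. z \<notin> qdisc q \<Longrightarrow> f z = 0"
    and "summable (\<lambda>n. qfact q n * (cmod (c n))\<^sup>2)"
  shows "f \<in> H2 q"
  using assms sums_imp_holomorphic[OF assms(2)] sums_imp_taylor_coeff[OF assms(1,2)]
  by (simp add: H2_def)

text \<open>Inside the disc both functions are sums of the same series; outside both vanish by
  convention.\<close>

lemma H2_eqI:
  assumes "f \<in> H2 q" "g \<in> H2 q" "\<And>n. taylor_coeff f n = taylor_coeff g n"
  shows "f = g"
proof
  fix z
  show "f z = g z"
  proof (cases "z \<in> qdisc q")
    case True
    have "(\<lambda>n. taylor_coeff g n * z ^ n) sums f z"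
      using taylor_sums[OF H2_holomorphic[OF assms(1)] True] by (simp only: assms(3))
    then show ?thesis
      using taylor_sums[OF H2_holomorphic[OF assms(2)] True] by (rule sums_unique2)
  next
    case False
    then show ?thesis
      using assms H2_outside by metis
  qed
qed

text \<open>Convergence is what later permits splitting off the first term of an inner
  product.\<close>

lemma H2_inner_summable:
  assumes "0 \<le> q" "f \<in> H2 q" "g \<in> H2 q"
  shows "summable (\<lambda>n. of_real (qfact q n) * taylor_coeff f n * cnj (taylor_coeff g n))"
proof (rule summable_comparison_test')
  show "summable (\<lambda>n. qfact q n * (cmod (taylor_coeff f n))\<^sup>2
                     + qfact q n * (cmod (taylor_coeff g n))\<^sup>2)"
    by (intro summable_add H2_summable assms)
  fix n
  let ?x = "cmod (taylor_coeff f n)" and ?y = "cmod (taylor_coeff g n)"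
  \<comment> \<open>From \<open>2 * x * y \<le> x^2 + y^2\<close> and
    \<open>x * y \<ge> 0\<close>.\<close>
  have "?x * ?y \<le> ?x\<^sup>2 + ?y\<^sup>2"
    using sum_squares_bound[of ?x ?y] mult_nonneg_nonneg[OF norm_ge_zero norm_ge_zero,
        of "taylor_coeff f n" "taylor_coeff g n"]
    unfolding mult.assoc by linarith
  then show "norm (of_real (qfact q n) * taylor_coeff f n * cnj (taylor_coeff g n))
        \<le> qfact q n * ?x\<^sup>2 + qfact q n * ?y\<^sup>2"
    using qfact_pos[OF assms(1), of n]
    by (simp add: norm_mult mult.assoc flip: distrib_left)
qed

lemma H2_inner_self:
  assumes "f \<in> H2 q"
  shows "Re (H2_inner q f f) = (\<Sum>n. qfact q n * (cmod (taylor_coeff f n))\<^sup>2)"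
proof -
  have "H2_inner q f f = (\<Sum>n. of_real (qfact q n * (cmod (taylor_coeff f n))\<^sup>2))"
    by (simp add: H2_inner_def mult.assoc flip: complex_norm_square)
  also have "\<dots> = of_real (\<Sum>n. qfact q n * (cmod (taylor_coeff f n))\<^sup>2)"
    by (rule suminf_of_real[OF H2_summable[OF assms], symmetric])
  finally show ?thesis
    by simp
qed

text \<open>This is the norm series of \<open>Mz f\<close> after reindexing; moving to the next
  weight costs at most the factor \<open>1 / (1 - q)\<close>.\<close>

lemma qfact_shift_summable:
  assumes "0 \<le> q" "q < 1" "f \<in> H2 q"
  shows "summable (\<lambda>n. qfact q (Suc n) * (cmod (taylor_coeff f n))\<^sup>2)"
proof (rule summable_comparison_test')
  show "summable (\<lambda>n. 1 / (1 - q) * (qfact q n * (cmod (taylor_coeff f n))\<^sup>2))"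
    by (intro summable_mult H2_summable assms)
  show "norm (qfact q (Suc n) * (cmod (taylor_coeff f n))\<^sup>2)
        \<le> 1 / (1 - q) * (qfact q n * (cmod (taylor_coeff f n))\<^sup>2)" for n
    using mult_right_mono[OF qfact_Suc_le[OF assms(1,2), of n], of "(cmod (taylor_coeff f n))\<^sup>2"]
      qfact_pos[OF assms(1), of "Suc n"]
    by (simp add: abs_mult)
qed

section \<open>Multiplication by z as a bounded operator\<close>

lemma Mz_in_H2:
  assumes "0 \<le> q" "q < 1" "f \<in> H2 q"
  shows "Mz f \<in> H2 q"
proof (rule H2I[OF assms(2) Mz_sums])
  show "f holomorphic_on qdisc q"
    by (rule H2_holomorphic[OF assms(3)])
  show "Mz f z = 0" if "z \<notin> qdisc q" for z
    using H2_outside[OF assms(3) that] by (simp add: Mz_def)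
  show "summable (\<lambda>n. qfact q n * (cmod (prepend0 (taylor_coeff f) n))\<^sup>2)"
    using qfact_shift_summable[OF assms] by (subst summable_Suc_iff[symmetric]) simp
qed

lemma Mz_norm_bound:
  assumes "0 \<le> q" "q < 1" "f \<in> H2 q"
  shows "Re (H2_inner q (Mz f) (Mz f)) \<le> 1 / (1 - q) * Re (H2_inner q f f)"
proof -
  note tc = taylor_coeff_Mz[OF assms(2) H2_holomorphic[OF assms(3)]]
  note Mz = Mz_in_H2[OF assms]
  \<comment> \<open>The first term of the norm series is 0 because \<open>Mz f\<close> has constant
    coefficient 0, so splitting it off only reindexes.\<close>
  have "Re (H2_inner q (Mz f) (Mz f)) = (\<Sum>n. qfact q (Suc n) * (cmod (taylor_coeff f n))\<^sup>2)"
    unfolding H2_inner_self[OF Mz]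
    using suminf_split_head[OF H2_summable[OF Mz]] by (simp add: tc)
  also have "\<dots> \<le> (\<Sum>n. 1 / (1 - q) * (qfact q n * (cmod (taylor_coeff f n))\<^sup>2))"
  proof (rule suminf_le)
    show "qfact q (Suc n) * (cmod (taylor_coeff f n))\<^sup>2
        \<le> 1 / (1 - q) * (qfact q n * (cmod (taylor_coeff f n))\<^sup>2)" for n
      using mult_right_mono[OF qfact_Suc_le[OF assms(1,2), of n], of "(cmod (taylor_coeff f n))\<^sup>2"]
      by simp
  qed (intro qfact_shift_summable summable_mult H2_summable assms)+
  also have "\<dots> = 1 / (1 - q) * Re (H2_inner q f f)"
    unfolding H2_inner_self[OF assms(3)] by (intro suminf_mult H2_summable assms)
  finally show ?thesis .
qed

lemma Mz_bounded:
  assumes "0 \<le> q" "q < 1"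
  shows "bounded_operator_on (H2 q) (H2_inner q) Mz"
  unfolding bounded_operator_on_def
proof (intro conjI allI ballI exI)
  fix f assume f: "f \<in> H2 q"
  show "Mz f \<in> H2 q"
    using Mz_in_H2[OF assms f] .
  \<comment> \<open>The witness for \<open>C\<close> is the square root of the constant in
    \<open>Mz_norm_bound\<close>.\<close>
  show "sqrt (Re (H2_inner q (Mz f) (Mz f))) \<le> sqrt (1 / (1 - q)) * sqrt (Re (H2_inner q f f))"
    using real_sqrt_le_mono[OF Mz_norm_bound[OF assms f]] by (simp only: real_sqrt_mult)
qed (auto simp: Mz_def algebra_simps)

section \<open>The adjoint\<close>

lemma RqMzR0_in_H2:
  assumes "0 \<le> q" "q < 1" "f \<in> H2 q"
  shows "Rq q (Mz (R0 q f)) \<in> H2 q"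
proof (rule H2I[OF assms(2) RqMzR0_sums[OF assms(1,2) H2_holomorphic[OF assms(3)]]])
  show "Rq q (Mz (R0 q f)) z = 0" if "z \<notin> qdisc q" for z
    using that by (simp add: Rq_def extend_at_0_def)
  let ?a = "taylor_coeff f"
  show "summable (\<lambda>n. qfact q n * (cmod (of_real (qnum q (Suc n)) * ?a (Suc n)))\<^sup>2)"
  proof (rule summable_comparison_test')
    show "summable (\<lambda>n. 1 / (1 - q) * (qfact q (Suc n) * (cmod (?a (Suc n)))\<^sup>2))"
      using H2_summable[OF assms(3)] by (intro summable_mult) (subst summable_Suc_iff)
    fix n
    \<comment> \<open>Of the two factors \<open>qnum q (Suc n)\<close> in the square, one raises the
      weight to \<open>qfact q (Suc n)\<close>; the other is bounded by
      \<open>1 / (1 - q)\<close>.\<close>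
    have "qfact q n * (cmod (of_real (qnum q (Suc n)) * ?a (Suc n)))\<^sup>2
        = qnum q (Suc n) * (qfact q (Suc n) * (cmod (?a (Suc n)))\<^sup>2)"
      by (simp add: qfact_Suc norm_mult power_mult_distrib power2_eq_square mult_ac)
    also have "\<dots> \<le> 1 / (1 - q) * (qfact q (Suc n) * (cmod (?a (Suc n)))\<^sup>2)"
      using qnum_le[OF assms(1,2)] qfact_pos[OF assms(1), of "Suc n"]
      by (intro mult_right_mono) auto
    finally show "norm (qfact q n * (cmod (of_real (qnum q (Suc n)) * ?a (Suc n)))\<^sup>2)
        \<le> 1 / (1 - q) * (qfact q (Suc n) * (cmod (?a (Suc n)))\<^sup>2)"
      using qfact_pos[OF assms(1), of n] by simp
  qed
qed

text \<open>The left-hand series starts with a zero term. After reindexing, its weight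
  \<open>qfact q (Suc n)\<close> splits as \<open>qnum q (Suc n) * qfact q n\<close>, and the first
  factor, being real, passes through \<open>cnj\<close> to the coefficient of
  \<open>g\<close>.\<close>

lemma H2_inner_Mz:
  assumes "0 \<le> q" "q < 1" "f \<in> H2 q" "g \<in> H2 q"
  shows "H2_inner q (Mz f) g = H2_inner q f (Rq q (Mz (R0 q g)))"
proof -
  have tc: "taylor_coeff (Rq q (Mz (R0 q g))) n
          = of_real (qnum q (Suc n)) * taylor_coeff g (Suc n)" for n
    by (rule sums_imp_taylor_coeff[OF assms(2)
          RqMzR0_sums[OF assms(1,2) H2_holomorphic[OF assms(4)]]])
  show ?thesis
    using suminf_split_head[OF H2_inner_summable[OF assms(1) Mz_in_H2[OF assms(1-3)] assms(4)]]
    by (simp add: H2_inner_def tc taylor_coeff_Mz[OF assms(2) H2_holomorphic[OF assms(3)]]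
        qfact_Suc mult_ac)
qed

text \<open>Pairing against monomials recovers the Taylor coefficients.\<close>

lemma H2_inner_determines:
  assumes "0 \<le> q" "q < 1" "g \<in> H2 q" "h \<in> H2 q"
    and eq: "\<And>f. f \<in> H2 q \<Longrightarrow> H2_inner q f g = H2_inner q f h"
  shows "g = h"
proof (rule H2_eqI[OF assms(3,4)])
  fix m :: nat
  let ?c = "\<lambda>n::nat. if n = m then 1 else 0 :: complex"
  \<comment> \<open>The monomial is cut off outside the disc, as membership in \<open>H2 q\<close>
    demands.\<close>
  define e where "e z = (if z \<in> qdisc q then z ^ m else 0)" for z
  have e_sums: "(\<lambda>n. ?c n * z ^ n) sums e z" if "z \<in> qdisc q" for z
    using that powser_sums_if[of m z] by (simp add: e_def)
  have tc: "taylor_coeff e n = ?c n" for n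
    by (rule sums_imp_taylor_coeff[OF assms(2) e_sums])
  have "summable (\<lambda>n. qfact q n * (cmod (?c n))\<^sup>2)"
    by (rule summable_finite[of "{m}"]) auto
  then have "e \<in> H2 q"
    by (intro H2I[OF assms(2) e_sums]) (simp_all add: e_def)
  moreover have "H2_inner q e k = of_real (qfact q m) * cnj (taylor_coeff k m)" for k
    unfolding H2_inner_def tc by (subst suminf_finite[of "{m}"]) auto
  \<comment> \<open>The weight is nonzero and conjugation is injective, so both cancel.\<close>
  ultimately show "taylor_coeff g m = taylor_coeff h m"
    using eq[of e] qfact_pos[OF assms(1), of m] by simp
qed

theorem theorem3p14:
  fixes q :: real
  assumes "0 \<le> q" and "q < 1"
  shows "bounded_operator_on (H2 q) (H2_inner q) Mz \<and>
         (\<forall>f\<in>H2 q. hadjoint (H2 q) (H2_inner q) Mz f = Rq q (Mz (R0 q f)))"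
proof (intro conjI ballI)
  show "bounded_operator_on (H2 q) (H2_inner q) Mz"
    by (rule Mz_bounded[OF assms])
  fix g assume g: "g \<in> H2 q"
  show "hadjoint (H2 q) (H2_inner q) Mz g = Rq q (Mz (R0 q g))"
    unfolding hadjoint_def
  \<comment> \<open>The description in \<open>hadjoint\<close> is met by an explicit element. Any
    other candidate has the same pairing with every \<open>f\<close>, namely
    \<open>H2_inner q (Mz f) g\<close>, and hence coincides with it.\<close>
  proof (rule the_equality)
    show "Rq q (Mz (R0 q g)) \<in> H2 q \<and>
        (\<forall>f\<in>H2 q. H2_inner q (Mz f) g = H2_inner q f (Rq q (Mz (R0 q g))))"
      using RqMzR0_in_H2[OF assms g] H2_inner_Mz[OF assms _ g] by blast
    show "h = Rq q (Mz (R0 q g))"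
      if "h \<in> H2 q \<and> (\<forall>f\<in>H2 q. H2_inner q (Mz f) g = H2_inner q f h)" for h
      using that RqMzR0_in_H2[OF assms g] H2_inner_Mz[OF assms _ g]
      by (intro H2_inner_determines[OF assms]) auto
  qed
qed

end
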